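(* Let $R\cong R_1\times R_2\times\cdots\times R_m$ be a finite principal ideal ring, where each $R_i$ is a finite chain ring having Loewy length $n_i$. Then, for every integer $k\ge 2$, $$\zeta_k(R)=\prod_{i=1}^{m}\left(1-\frac{\displaystyle\sum_{t=0}^{n_i-1}\ \sum_{j=0}^{\left\lfloor\frac{t}{n_i+1}\right\rfloor}(-1)^j\binom{k}{j}\binom{t-j(n_i+1)+k-1}{k-1}}{(n_i+1)^k}\right).$$ Consequently, the ideal zero-product probability of a finite principal ideal ring is completely determined by the Loewy lengths of its chain-ring components.
   Context: A finite chain ring $(R,M)$ is a finite (nonzero) commutative ring with identity whose ideals are linearly ordered by inclusion; $M$ denotes its unique maximal ideal. Its Loewy length is the smallest positive integer $n$ with $M^n=(0)$. A finite principal ideal ring is a finite commutative ring with identity in which every ideal is principal; every such ring is isomorphic to a finite direct product of finite chain rings (its chain-ring components). For a finite commutative ring $R$, let $\mathcal I(R)$ denote the set of all ideals of $R$. For an integer $k\ge 2$, the ideal zero-product probability is $$\zeta_k(R)=\frac{|\{(I_1,\ldots,I_k)\in\mathcal I(R)^k : I_1I_2\cdots I_k=(0)\}|}{|\mathcal I(R)|^k},$$ where $I_1\cdots I_k$ is the usual product of ideals. Convention: $\binom{m}{r}=0$ whenever $m<r$ or $m<0$. *)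

theory Defs
  imports "HOL-Algebra.Algebra"
begin

locale finite_chain_ring = cring +
  assumes finite_carrier: "finite (carrier R)"
    and nonzero: "\<one> \<noteq> \<zero>"
    and ideals_linear: "\<lbrakk> ideal I R; ideal J R \<rbrakk> \<Longrightarrow> I \<subseteq> J \<or> J \<subseteq> I"

locale finite_principal_ideal_ring = cring +
  assumes finite_carrier: "finite (carrier R)"
    and ideals_principal: "ideal I R \<Longrightarrow> principalideal I R"

(* Meant for local rings only: otherwise the description THE is unspecified. *)
definition the_maximal_ideal :: "('a, 'b) ring_scheme \<Rightarrow> 'a set" where
  "the_maximal_ideal R = (THE M. maximalideal M R)"

(* Powers of an ideal are powers in ideals_set R, whose multiplication is the product of ideals
   and whose unit is the ideal carrier R. *)
definition loewy_length :: "('a, 'b) ring_scheme \<Rightarrow> nat" where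
  "loewy_length R =
     (LEAST n. 0 < n \<and> the_maximal_ideal R [^]\<^bsub>ideals_set R\<^esub> n = {\<zero>\<^bsub>R\<^esub>})"

(* A k-tuple of ideals is an extensional function on {..<k}. The product of its entries is a
   finprod; see ideals_set_is_comm_monoid. *)
definition zero_product_tuples :: "nat \<Rightarrow> ('a, 'b) ring_scheme \<Rightarrow> (nat \<Rightarrow> 'a set) set" where
  "zero_product_tuples k R =
     {I \<in> {..<k} \<rightarrow>\<^sub>E {J. ideal J R}. (\<Otimes>\<^bsub>ideals_set R\<^esub>i\<in>{..<k}. I i) = {\<zero>\<^bsub>R\<^esub>}}"

definition ideal_zero_prod_prob :: "nat \<Rightarrow> ('a, 'b) ring_scheme \<Rightarrow> real" where
  "ideal_zero_prod_prob k R =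
     real (card (zero_product_tuples k R)) / real (card {J. ideal J R}) ^ k"

lemma (in finite_chain_ring) maximalideal_the_maximal_ideal:
  "maximalideal (the_maximal_ideal R) R"
proof -
  let ?P = "{I. ideal I R \<and> I \<noteq> carrier R}"
  have "?P \<subseteq> Pow (carrier R)"
    using ideal.Icarr by fastforce
  then have fin: "finite ?P"
    using finite_carrier finite_subset by blast
  have "{\<zero>} \<in> ?P"
    using zeroideal nonzero one_closed by auto
  then obtain M where M: "M \<in> ?P" "\<And>J. J \<in> ?P \<Longrightarrow> M \<subseteq> J \<Longrightarrow> M = J"
    using finite_has_maximal[OF fin] by (metis (no_types, lifting) empty_iff)
  have max: "maximalideal M R"
    using M by (intro maximalidealI) auto
  have "N = M" if N: "maximalideal N R" for N
  proof -
    have "ideal N R" "ideal M R" "N \<noteq> carrier R" "M \<noteq> carrier R"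
      using N max by (auto simp: maximalideal_def maximalideal_axioms_def)
    moreover have "N \<subseteq> carrier R" "M \<subseteq> carrier R"
      using calculation by (auto dest: ideal.Icarr)
    ultimately show ?thesis
      using maximalideal.I_maximal[OF N, of M] maximalideal.I_maximal[OF max, of N]
        ideals_linear[of M N] by auto
  qed
  then show ?thesis
    unfolding the_maximal_ideal_def using max by (metis (mono_tags, lifting) theI)
qed

end

theory Submission
  imports Defs
begin

text \<open>The probability depends only on the commutative monoid of ideals and its element \<open>(0)\<close>. This
  monoid is invariant under ring isomorphism and takes direct products of rings to direct products,
  so \<open>\<zeta>\<^sub>k\<close> is multiplicative. In a chain ring of Loewy length \<open>n\<close> every ideal is \<open>M\<^sup>i\<close> for a
  unique \<open>i \<le> n\<close>, so the monoid is \<open>{0, \<dots>, n}\<close> with addition truncated at \<open>n\<close>, and a product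
  of ideals is nonzero iff its exponents sum to some \<open>t < n\<close>. Stars and bars counts these tuples; the
  bound \<open>n\<close> on the exponents is automatic, which is why only the terms \<open>j = 0\<close> occur in the stated
  inclusion-exclusion formula.\<close>

subsection \<open>Tuples with a prescribed product in a commutative monoid\<close>

text \<open>Multiplicativity alone does not make a map of monoids preserve the unit, so that is a
  separate assumption. It settles the empty index set and also an infinite one, where
  \<open>finprod\<close> is the unit by default.\<close>

lemma finprod_hom:
  assumes G: "comm_monoid G" and H: "comm_monoid H"
    and h: "h \<in> hom G H" "h \<one>\<^bsub>G\<^esub> = \<one>\<^bsub>H\<^esub>"
    and f: "f \<in> A \<rightarrow> carrier G"
  shows "h (finprod G f A) = finprod H (\<lambda>i. h (f i)) A"
proof -
  interpret G: comm_monoid G by fact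
  interpret H: comm_monoid H by fact
  show ?thesis using f
  proof (induct A rule: infinite_finite_induct)
    case (infinite A)
    then show ?case by (simp add: h(2))
  next
    case empty
    then show ?case by (simp add: h(2))
  next
    case (insert x F)
    then have "f \<in> F \<rightarrow> carrier G" "f x \<in> carrier G" by auto
    moreover have "(\<lambda>i. h (f i)) \<in> F \<rightarrow> carrier H" "h (f x) \<in> carrier H"
      using calculation h(1) by (auto simp: hom_def Pi_iff)
    ultimately show ?case
      using insert by (simp add: hom_mult[OF h(1)])
  qed
qed

text \<open>The tuples of \<open>zero_product_tuples\<close> for an arbitrary monoid, because the
  counting is later moved to a monoid of natural numbers.\<close>

definition tuples_with_product :: "nat \<Rightarrow> ('a, 'b) monoid_scheme \<Rightarrow> 'a \<Rightarrow> (nat \<Rightarrow> 'a) set" where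
  "tuples_with_product k G z = {f \<in> {..<k} \<rightarrow>\<^sub>E carrier G. finprod G f {..<k} = z}"

lemma zero_product_tuples_eq:
  "zero_product_tuples k R = tuples_with_product k (ideals_set R) {\<zero>\<^bsub>R\<^esub>}"
  by (simp add: zero_product_tuples_def tuples_with_product_def ideals_set_def)

text \<open>Applying \<open>h\<close> to every entry is a bijection of tuples, inverted by applying
  the inverse of \<open>h\<close> entrywise; products correspond because \<open>h\<close> commutes
  with \<open>finprod\<close>.\<close>

lemma card_tuples_with_product_iso:
  assumes G: "comm_monoid G" and H: "comm_monoid H"
    and h: "h \<in> iso G H" "h \<one>\<^bsub>G\<^esub> = \<one>\<^bsub>H\<^esub>"
    and z: "z \<in> carrier G"
  shows "card (tuples_with_product k G z) = card (tuples_with_product k H (h z))"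
proof -
  interpret G: comm_monoid G by fact
  interpret H: comm_monoid H by fact
  let ?g = "inv_into (carrier G) h"
  have hom: "h \<in> hom G H" and bij: "bij_betw h (carrier G) (carrier H)"
    using h by (auto simp: iso_def)
  note inj = bij_betw_imp_inj_on[OF bij]
  have hg: "y \<in> carrier H \<Longrightarrow> h (?g y) = y" for y
    using bij by (meson bij_betw_inv_into_right)
  have gh: "x \<in> carrier G \<Longrightarrow> ?g (h x) = x" for x
    using bij by (meson bij_betw_inv_into_left)
  have hc: "x \<in> carrier G \<Longrightarrow> h x \<in> carrier H" for x
    using bij by (meson bij_betwE)
  have gc: "y \<in> carrier H \<Longrightarrow> ?g y \<in> carrier G" for y
    using bij by (meson bij_betwE bij_betw_inv_into)
  have prod_iff: "finprod H (\<lambda>i. h (f i)) {..<k} = h z \<longleftrightarrow> finprod G f {..<k} = z"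
    if "f \<in> {..<k} \<rightarrow> carrier G" for f
    using finprod_hom[OF G H hom h(2) that] inj z G.finprod_closed[OF that]
    by (metis inj_on_eq_iff)
  \<comment> \<open>Restriction to \<open>{..<k}\<close> makes the image tuple extensional; it
    changes no factor, hence not the product.\<close>
  have restr: "finprod H (\<lambda>i\<in>{..<k}. h (f i)) {..<k} = finprod H (\<lambda>i. h (f i)) {..<k}"
    if "f \<in> {..<k} \<rightarrow> carrier G" for f
    using that hc by (intro H.finprod_cong') auto
  have prod_back: "finprod H (\<lambda>i. h ((\<lambda>i\<in>{..<k}. ?g (f i)) i)) {..<k} = finprod H f {..<k}"
    if "f \<in> {..<k} \<rightarrow> carrier H" for f
    using that hg by (intro H.finprod_cong') auto
  have "bij_betw (\<lambda>f. \<lambda>i\<in>{..<k}. h (f i)) (tuples_with_product k G z)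
          (tuples_with_product k H (h z))"
  proof (rule bij_betw_byWitness[where f' = "\<lambda>f. \<lambda>i\<in>{..<k}. ?g (f i)"])
    show "\<forall>f\<in>tuples_with_product k G z. (\<lambda>i\<in>{..<k}. ?g ((\<lambda>i\<in>{..<k}. h (f i)) i)) = f"
      by (auto simp: tuples_with_product_def fun_eq_iff gh PiE_iff extensional_def)
    show "\<forall>f\<in>tuples_with_product k H (h z). (\<lambda>i\<in>{..<k}. h ((\<lambda>i\<in>{..<k}. ?g (f i)) i)) = f"
      by (auto simp: tuples_with_product_def fun_eq_iff hg PiE_iff extensional_def)
    show "(\<lambda>f. \<lambda>i\<in>{..<k}. h (f i)) ` tuples_with_product k G z \<subseteq> tuples_with_product k H (h z)"
    proof (rule image_subsetI)
      fix f assume "f \<in> tuples_with_product k G z"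
      then have fc: "f \<in> {..<k} \<rightarrow> carrier G" and fz: "finprod G f {..<k} = z"
        by (auto simp: tuples_with_product_def)
      have "(\<lambda>i\<in>{..<k}. h (f i)) \<in> {..<k} \<rightarrow>\<^sub>E carrier H"
        using fc hc by auto
      then show "(\<lambda>i\<in>{..<k}. h (f i)) \<in> tuples_with_product k H (h z)"
        using restr[OF fc] prod_iff[OF fc] fz by (simp add: tuples_with_product_def)
    qed
    show "(\<lambda>f. \<lambda>i\<in>{..<k}. ?g (f i)) ` tuples_with_product k H (h z) \<subseteq> tuples_with_product k G z"
    proof (rule image_subsetI)
      fix f assume f: "f \<in> tuples_with_product k H (h z)"
      then have fc: "f \<in> {..<k} \<rightarrow> carrier H" and fz: "finprod H f {..<k} = h z"
        by (auto simp: tuples_with_product_def)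
      have c: "(\<lambda>i\<in>{..<k}. ?g (f i)) \<in> {..<k} \<rightarrow>\<^sub>E carrier G"
        using fc gc by auto
      \<comment> \<open>\<open>PiE\<close> is an intersection with \<open>extensional\<close>; the
        first conjunct of membership in it is the \<open>Pi\<close> hypothesis that
        \<open>prod_iff\<close> asks for.\<close>
      then show "(\<lambda>i\<in>{..<k}. ?g (f i)) \<in> tuples_with_product k G z"
        using prod_iff[of "\<lambda>i\<in>{..<k}. ?g (f i)", OF Int_iff[THEN iffD1, THEN conjunct1, OF c[unfolded PiE_def]]] prod_back[OF fc] fz
        by (simp add: tuples_with_product_def)
    qed
  qed
  then show ?thesis by (rule bij_betw_same_card)
qed

lemma comm_monoid_DirProd:
  assumes "comm_monoid G" "comm_monoid H"
  shows "comm_monoid (G \<times>\<times> H)"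
proof -
  interpret G: comm_monoid G by fact
  interpret H: comm_monoid H by fact
  interpret GH: monoid "G \<times>\<times> H"
    by (rule DirProd_monoid) unfold_locales
  show ?thesis
    by unfold_locales (auto simp: G.m_comm H.m_comm)
qed

text \<open>A tuple of pairs amounts to a pair of tuples. Both projections are monoid homomorphisms,
  so products are formed componentwise.\<close>

lemma card_tuples_with_product_DirProd:
  assumes G: "comm_monoid G" and H: "comm_monoid H"
  shows "card (tuples_with_product k (G \<times>\<times> H) (z, w)) =
         card (tuples_with_product k G z) * card (tuples_with_product k H w)"
proof -
  interpret G: comm_monoid G by fact
  interpret H: comm_monoid H by fact
  interpret GH: comm_monoid "G \<times>\<times> H"
    by (rule comm_monoid_DirProd) fact+
  let ?T = tuples_with_product
  have fst: "fst (finprod (G \<times>\<times> H) f {..<k}) = finprod G (\<lambda>i\<in>{..<k}. fst (f i)) {..<k}"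
    and snd: "snd (finprod (G \<times>\<times> H) f {..<k}) = finprod H (\<lambda>i\<in>{..<k}. snd (f i)) {..<k}"
    if f: "f \<in> {..<k} \<rightarrow> carrier (G \<times>\<times> H)" for f
  proof -
    have "fst (finprod (G \<times>\<times> H) f {..<k}) = finprod G (\<lambda>i. fst (f i)) {..<k}"
      by (rule finprod_hom[OF GH.comm_monoid_axioms G _ _ f]) (auto simp: hom_def)
    also have "\<dots> = finprod G (\<lambda>i\<in>{..<k}. fst (f i)) {..<k}"
      using f by (intro G.finprod_cong') (auto simp: Pi_iff mem_Times_iff)
    finally show "fst (finprod (G \<times>\<times> H) f {..<k}) = \<dots>" .
    have "snd (finprod (G \<times>\<times> H) f {..<k}) = finprod H (\<lambda>i. snd (f i)) {..<k}"
      by (rule finprod_hom[OF GH.comm_monoid_axioms H _ _ f]) (auto simp: hom_def)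
    also have "\<dots> = finprod H (\<lambda>i\<in>{..<k}. snd (f i)) {..<k}"
      using f by (intro H.finprod_cong') (auto simp: Pi_iff mem_Times_iff)
    finally show "snd (finprod (G \<times>\<times> H) f {..<k}) = \<dots>" .
  qed
  have mem: "f \<in> ?T k (G \<times>\<times> H) (z, w) \<longleftrightarrow> f \<in> extensional {..<k} \<and>
      (\<lambda>i\<in>{..<k}. fst (f i)) \<in> ?T k G z \<and> (\<lambda>i\<in>{..<k}. snd (f i)) \<in> ?T k H w" for f
    using fst[of f] snd[of f]
    by (auto simp: tuples_with_product_def PiE_iff Pi_iff mem_Times_iff prod_eq_iff)
  have "bij_betw (\<lambda>f. (\<lambda>i\<in>{..<k}. fst (f i), \<lambda>i\<in>{..<k}. snd (f i)))
          (?T k (G \<times>\<times> H) (z, w)) (?T k G z \<times> ?T k H w)"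
  proof (rule bij_betw_byWitness[where f' = "\<lambda>(a, b). \<lambda>i\<in>{..<k}. (a i, b i)"])
    show "\<forall>f\<in>?T k (G \<times>\<times> H) (z, w).
        (\<lambda>(a, b). \<lambda>i\<in>{..<k}. (a i, b i)) (\<lambda>i\<in>{..<k}. fst (f i), \<lambda>i\<in>{..<k}. snd (f i)) = f"
      by (auto simp: mem fun_eq_iff extensional_def)
    show "\<forall>p\<in>?T k G z \<times> ?T k H w.
        (\<lambda>i\<in>{..<k}. fst ((\<lambda>(a, b). \<lambda>i\<in>{..<k}. (a i, b i)) p i),
         \<lambda>i\<in>{..<k}. snd ((\<lambda>(a, b). \<lambda>i\<in>{..<k}. (a i, b i)) p i)) = p"
      by (auto simp: tuples_with_product_def fun_eq_iff PiE_iff extensional_def)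
    show "(\<lambda>f. (\<lambda>i\<in>{..<k}. fst (f i), \<lambda>i\<in>{..<k}. snd (f i))) ` ?T k (G \<times>\<times> H) (z, w)
        \<subseteq> ?T k G z \<times> ?T k H w"
      by (auto simp: mem)
    have "(\<lambda>i\<in>{..<k}. a i) = a" if "a \<in> ?T k G z" for a
      using that by (auto simp: tuples_with_product_def PiE_iff extensional_restrict)
    moreover have "(\<lambda>i\<in>{..<k}. b i) = b" if "b \<in> ?T k H w" for b
      using that by (auto simp: tuples_with_product_def PiE_iff extensional_restrict)
    ultimately show "(\<lambda>(a, b). \<lambda>i\<in>{..<k}. (a i, b i)) ` (?T k G z \<times> ?T k H w)
        \<subseteq> ?T k (G \<times>\<times> H) (z, w)"
      by (auto simp: mem cong: restrict_cong)
  qed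
  then show ?thesis
    by (auto dest: bij_betw_same_card simp: card_cartesian_product)
qed

subsection \<open>Ideals under isomorphisms and direct products\<close>

lemma ideals_set_simps [simp]:
  "carrier (ideals_set R) = {I. ideal I R}"
  "monoid.mult (ideals_set R) = ideal_prod R"
  "monoid.one (ideals_set R) = carrier R"
  by (simp_all add: ideals_set_def)

text \<open>The image is the preimage of \<open>I\<close> under the inverse isomorphism, and
  preimages of ideals under homomorphisms are ideals.\<close>

lemma ring_iso_image_ideal:
  assumes R: "ring R" and S: "ring S" and h: "h \<in> ring_iso R S" and I: "ideal I R"
  shows "ideal (h ` I) S"
proof -
  let ?g = "inv_into (carrier R) h"
  have bij: "bij_betw h (carrier R) (carrier S)"
    using h by (rule ring_iso_memE)
  have "?g \<in> ring_hom S R"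
    using ring_iso_set_sym[OF R h] by (simp add: ring_iso_def)
  then have "ideal {s \<in> carrier S. ?g s \<in> I} S"
    using R S I by (intro ring_hom_ring.ideal_vimage ring_hom_ringI2)
  also have "{s \<in> carrier S. ?g s \<in> I} = h ` I"
    using bij ideal.Icarr[OF I]
    by (auto simp: bij_betw_inv_into_left image_iff bij_betw_inv_into_right dest: bij_betwE)
       (metis bij_betw_inv_into_right)
  finally show ?thesis .
qed

text \<open>\<open>ideal_prod\<close> is inductive, generated by products of elements and closed
  under sums, so each inclusion is an induction along which \<open>h\<close> passes through both
  operations.\<close>

lemma ring_iso_image_ideal_prod:
  assumes h: "h \<in> ring_iso R S" and R: "ring R" and I: "ideal I R" and J: "ideal J R"
  shows "h ` (I \<cdot>\<^bsub>R\<^esub> J) = (h ` I) \<cdot>\<^bsub>S\<^esub> (h ` J)"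
proof (intro equalityI subsetI)
  note carr = ideal.Icarr[OF I] ideal.Icarr[OF J] subsetD[OF ring.ideal_prod_in_carrier[OF R I J]]
  fix y assume "y \<in> h ` (I \<cdot>\<^bsub>R\<^esub> J)"
  then obtain x where x: "x \<in> I \<cdot>\<^bsub>R\<^esub> J" "y = h x" by blast
  from x(1) have "h x \<in> (h ` I) \<cdot>\<^bsub>S\<^esub> (h ` J)"
    by induct (auto simp: carr ring_iso_memE(2,3)[OF h] intro: ideal_prod.intros)
  with x show "y \<in> (h ` I) \<cdot>\<^bsub>S\<^esub> (h ` J)" by simp
next
  note carr = ideal.Icarr[OF I] ideal.Icarr[OF J] subsetD[OF ring.ideal_prod_in_carrier[OF R I J]]
  fix y assume "y \<in> (h ` I) \<cdot>\<^bsub>S\<^esub> (h ` J)"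
  then show "y \<in> h ` (I \<cdot>\<^bsub>R\<^esub> J)"
  proof induct
    case (prod i j)
    then obtain a b where "a \<in> I" "b \<in> J" "i = h a" "j = h b" by blast
    then show ?case
      by (intro image_eqI[of _ _ "a \<otimes>\<^bsub>R\<^esub> b"])
         (auto simp: carr ring_iso_memE(2,3)[OF h] intro: ideal_prod.intros)
  next
    case (sum s1 s2)
    then obtain a b where "a \<in> I \<cdot>\<^bsub>R\<^esub> J" "b \<in> I \<cdot>\<^bsub>R\<^esub> J" "s1 = h a" "s2 = h b" by blast
    then show ?case
      by (intro image_eqI[of _ _ "a \<oplus>\<^bsub>R\<^esub> b"])
         (auto simp: carr ring_iso_memE(2,3)[OF h] intro: ideal_prod.intros)
  qed
qed

lemma ring_iso_ideals_set_iso: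
  assumes R: "ring R" and S: "ring S" and h: "h \<in> ring_iso R S"
  shows "image h \<in> iso (ideals_set R) (ideals_set S)"
proof -
  let ?g = "inv_into (carrier R) h"
  have g: "?g \<in> ring_iso S R" by (rule ring_iso_set_sym) fact+
  have bij: "bij_betw h (carrier R) (carrier S)"
    using h by (rule ring_iso_memE)
  have "bij_betw (image h) {I. ideal I R} {J. ideal J S}"
  proof (rule bij_betw_byWitness[where f' = "image ?g"])
    show "\<forall>I\<in>{I. ideal I R}. ?g ` h ` I = I"
    proof
      fix I assume "I \<in> {I. ideal I R}"
      then have "I \<subseteq> carrier R" using ideal.Icarr by fastforce
      then show "?g ` h ` I = I"
        using bij by (meson bij_betw_imp_inj_on inv_into_image_cancel)
    qed
    show "\<forall>J\<in>{J. ideal J S}. h ` ?g ` J = J"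
    proof
      fix J assume "J \<in> {J. ideal J S}"
      then have "J \<subseteq> carrier S" using ideal.Icarr by fastforce
      then show "h ` ?g ` J = J"
        using bij by (metis bij_betw_imp_surj_on image_inv_into_cancel)
    qed
  qed (use ring_iso_image_ideal R S h g in auto)
  then show ?thesis
    using ring_iso_image_ideal_prod[OF h R] ring_iso_image_ideal[OF R S h]
    by (auto simp: iso_def hom_def)
qed

lemma ideal_zero_prod_prob_iso:
  assumes R: "cring R" and S: "cring S" and "R \<simeq> S"
  shows "ideal_zero_prod_prob k R = ideal_zero_prod_prob k S"
proof -
  interpret R: cring R by fact
  interpret S: cring S by fact
  obtain h where h: "h \<in> ring_iso R S"
    using assms(3) by (auto simp: is_ring_iso_def)
  note iso = ring_iso_ideals_set_iso[OF R.ring_axioms S.ring_axioms h]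
  have "h \<zero>\<^bsub>R\<^esub> = \<zero>\<^bsub>S\<^esub>"
    using ring_hom_zero[of h R S] h R.ring_axioms S.ring_axioms by (auto simp: ring_iso_def)
  \<comment> \<open>The whole ring is the unit of the monoid of ideals, so this is preservation of
    the unit by \<open>image h\<close>.\<close>
  moreover have "h ` carrier R = carrier S"
    using ring_iso_memE(5)[OF h] by (rule bij_betw_imp_surj_on)
  moreover have "card (carrier (ideals_set R)) = card (carrier (ideals_set S))"
    using iso by (intro bij_betw_same_card) (auto simp: iso_def)
  ultimately show ?thesis
    using card_tuples_with_product_iso[OF R.ideals_set_is_comm_monoid S.ideals_set_is_comm_monoid iso,
        of "{\<zero>\<^bsub>R\<^esub>}" k] R.zeroideal
    by (simp add: ideal_zero_prod_prob_def zero_product_tuples_eq)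
qed

section \<open>Direct products of two rings\<close>

lemma RDirProd_simps [simp]:
  "carrier (RDirProd R S) = carrier R \<times> carrier S"
  "(a, b) \<otimes>\<^bsub>RDirProd R S\<^esub> (c, d) = (a \<otimes>\<^bsub>R\<^esub> c, b \<otimes>\<^bsub>S\<^esub> d)"
  "(a, b) \<oplus>\<^bsub>RDirProd R S\<^esub> (c, d) = (a \<oplus>\<^bsub>R\<^esub> c, b \<oplus>\<^bsub>S\<^esub> d)"
  "\<one>\<^bsub>RDirProd R S\<^esub> = (\<one>\<^bsub>R\<^esub>, \<one>\<^bsub>S\<^esub>)"
  "\<zero>\<^bsub>RDirProd R S\<^esub> = (\<zero>\<^bsub>R\<^esub>, \<zero>\<^bsub>S\<^esub>)"
  by (simp_all add: RDirProd_def DirProd_def monoid.defs)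

lemma RDirProd_cring:
  assumes "cring R" "cring S"
  shows "cring (RDirProd R S)"
proof -
  interpret R: cring R by fact
  interpret S: cring S by fact
  interpret RS: ring "RDirProd R S"
    by (rule RDirProd_ring) unfold_locales
  show ?thesis
    by unfold_locales (auto simp: R.m_comm S.m_comm)
qed

lemma RDirProd_hom_fst: "fst \<in> ring_hom (RDirProd R S) R"
  and RDirProd_hom_snd: "snd \<in> ring_hom (RDirProd R S) S"
  by (auto simp: ring_hom_def)

text \<open>The set is the intersection of the preimages of \<open>I\<close> and \<open>J\<close>
  under the two projections.\<close>

lemma RDirProd_ideal_Times:
  assumes R: "ring R" and S: "ring S" and I: "ideal I R" and J: "ideal J S"
  shows "ideal (I \<times> J) (RDirProd R S)"
proof -
  interpret RS: ring "RDirProd R S"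
    by (rule RDirProd_ring) fact+
  have "ideal {p \<in> carrier (RDirProd R S). fst p \<in> I} (RDirProd R S)"
    by (rule ring_hom_ring.ideal_vimage[OF ring_hom_ringI2[OF RS.ring_axioms R RDirProd_hom_fst] I])
  moreover have "ideal {p \<in> carrier (RDirProd R S). snd p \<in> J} (RDirProd R S)"
    by (rule ring_hom_ring.ideal_vimage[OF ring_hom_ringI2[OF RS.ring_axioms S RDirProd_hom_snd] J])
  ultimately have "ideal ({p \<in> carrier (RDirProd R S). fst p \<in> I} \<inter>
      {p \<in> carrier (RDirProd R S). snd p \<in> J}) (RDirProd R S)"
    by (rule RS.i_intersect)
  also have "{p \<in> carrier (RDirProd R S). fst p \<in> I} \<inter>
      {p \<in> carrier (RDirProd R S). snd p \<in> J} = I \<times> J"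
    using ideal.Icarr[OF I] ideal.Icarr[OF J] by auto
  finally show ?thesis .
qed

text \<open>Multiplication by the idempotents \<open>(1, 0)\<close> and \<open>(0, 1)\<close> splits
  an element \<open>(a, b)\<close> of \<open>K\<close> into \<open>(a, 0)\<close> and
  \<open>(0, b)\<close>, both in \<open>K\<close>, and their sum recovers
  \<open>(a, b)\<close>.\<close>

lemma RDirProd_ideal_sections:
  assumes R: "ring R" and S: "ring S" and K: "ideal K (RDirProd R S)"
  shows "ideal {a \<in> carrier R. (a, \<zero>\<^bsub>S\<^esub>) \<in> K} R"
    and "ideal {b \<in> carrier S. (\<zero>\<^bsub>R\<^esub>, b) \<in> K} S"
    and "K = {a \<in> carrier R. (a, \<zero>\<^bsub>S\<^esub>) \<in> K} \<times> {b \<in> carrier S. (\<zero>\<^bsub>R\<^esub>, b) \<in> K}"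
proof -
  interpret R: ring R by fact
  interpret S: ring S by fact
  interpret RS: ring "RDirProd R S"
    by (rule RDirProd_ring) fact+
  interpret K: ideal K "RDirProd R S" by fact
  have z: "(\<zero>\<^bsub>R\<^esub>, \<zero>\<^bsub>S\<^esub>) \<in> K" using K.zero_closed by simp
  show "ideal {a \<in> carrier R. (a, \<zero>\<^bsub>S\<^esub>) \<in> K} R"
  proof (rule idealI[OF R])
    show "subgroup {a \<in> carrier R. (a, \<zero>\<^bsub>S\<^esub>) \<in> K} (add_monoid R)"
    proof (rule R.add.subgroupI)
      fix a assume a: "a \<in> {a \<in> carrier R. (a, \<zero>\<^bsub>S\<^esub>) \<in> K}"
      \<comment> \<open>Closure under negation comes from absorption: the negative of
        \<open>(a, 0)\<close> is its multiple by \<open>(-1, 0)\<close>.\<close>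
      then show "\<ominus>\<^bsub>R\<^esub> a \<in> {a \<in> carrier R. (a, \<zero>\<^bsub>S\<^esub>) \<in> K}"
        using K.I_l_closed[of "(a, \<zero>\<^bsub>S\<^esub>)" "(\<ominus>\<^bsub>R\<^esub> \<one>\<^bsub>R\<^esub>, \<zero>\<^bsub>S\<^esub>)"] by (auto simp: R.l_minus)
      fix b assume "b \<in> {a \<in> carrier R. (a, \<zero>\<^bsub>S\<^esub>) \<in> K}"
      with a show "a \<oplus>\<^bsub>R\<^esub> b \<in> {a \<in> carrier R. (a, \<zero>\<^bsub>S\<^esub>) \<in> K}"
        using K.a_closed[of "(a, \<zero>\<^bsub>S\<^esub>)" "(b, \<zero>\<^bsub>S\<^esub>)"] by auto
    qed (use z in auto)
  next
    fix a x assume "a \<in> {a \<in> carrier R. (a, \<zero>\<^bsub>S\<^esub>) \<in> K}" "x \<in> carrier R"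
    then show "x \<otimes>\<^bsub>R\<^esub> a \<in> {a \<in> carrier R. (a, \<zero>\<^bsub>S\<^esub>) \<in> K}"
      "a \<otimes>\<^bsub>R\<^esub> x \<in> {a \<in> carrier R. (a, \<zero>\<^bsub>S\<^esub>) \<in> K}"
      using K.I_l_closed[of "(a, \<zero>\<^bsub>S\<^esub>)" "(x, \<zero>\<^bsub>S\<^esub>)"] K.I_r_closed[of "(a, \<zero>\<^bsub>S\<^esub>)" "(x, \<zero>\<^bsub>S\<^esub>)"]
      by auto
  qed
  show "ideal {b \<in> carrier S. (\<zero>\<^bsub>R\<^esub>, b) \<in> K} S"
  proof (rule idealI[OF S])
    show "subgroup {b \<in> carrier S. (\<zero>\<^bsub>R\<^esub>, b) \<in> K} (add_monoid S)"
    proof (rule S.add.subgroupI)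
      fix a assume a: "a \<in> {b \<in> carrier S. (\<zero>\<^bsub>R\<^esub>, b) \<in> K}"
      then show "\<ominus>\<^bsub>S\<^esub> a \<in> {b \<in> carrier S. (\<zero>\<^bsub>R\<^esub>, b) \<in> K}"
        using K.I_l_closed[of "(\<zero>\<^bsub>R\<^esub>, a)" "(\<zero>\<^bsub>R\<^esub>, \<ominus>\<^bsub>S\<^esub> \<one>\<^bsub>S\<^esub>)"] by (auto simp: S.l_minus)
      fix b assume "b \<in> {b \<in> carrier S. (\<zero>\<^bsub>R\<^esub>, b) \<in> K}"
      with a show "a \<oplus>\<^bsub>S\<^esub> b \<in> {b \<in> carrier S. (\<zero>\<^bsub>R\<^esub>, b) \<in> K}"
        using K.a_closed[of "(\<zero>\<^bsub>R\<^esub>, a)" "(\<zero>\<^bsub>R\<^esub>, b)"] by auto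
    qed (use z in auto)
  next
    fix a x assume "a \<in> {b \<in> carrier S. (\<zero>\<^bsub>R\<^esub>, b) \<in> K}" "x \<in> carrier S"
    then show "x \<otimes>\<^bsub>S\<^esub> a \<in> {b \<in> carrier S. (\<zero>\<^bsub>R\<^esub>, b) \<in> K}"
      "a \<otimes>\<^bsub>S\<^esub> x \<in> {b \<in> carrier S. (\<zero>\<^bsub>R\<^esub>, b) \<in> K}"
      using K.I_l_closed[of "(\<zero>\<^bsub>R\<^esub>, a)" "(\<zero>\<^bsub>R\<^esub>, x)"] K.I_r_closed[of "(\<zero>\<^bsub>R\<^esub>, a)" "(\<zero>\<^bsub>R\<^esub>, x)"]
      by auto
  qed
  have "(a, \<zero>\<^bsub>S\<^esub>) \<in> K" "(\<zero>\<^bsub>R\<^esub>, b) \<in> K" "a \<in> carrier R" "b \<in> carrier S" if "(a, b) \<in> K" for a b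
  proof -
    show ab: "a \<in> carrier R" "b \<in> carrier S" using K.Icarr[OF that] by auto
    show "(a, \<zero>\<^bsub>S\<^esub>) \<in> K" "(\<zero>\<^bsub>R\<^esub>, b) \<in> K"
      using K.I_l_closed[OF that, of "(\<one>\<^bsub>R\<^esub>, \<zero>\<^bsub>S\<^esub>)"] K.I_l_closed[OF that, of "(\<zero>\<^bsub>R\<^esub>, \<one>\<^bsub>S\<^esub>)"] ab
      by auto
  qed
  moreover have "(a, b) \<in> K"
    if "(a, \<zero>\<^bsub>S\<^esub>) \<in> K" "(\<zero>\<^bsub>R\<^esub>, b) \<in> K" "a \<in> carrier R" "b \<in> carrier S" for a b
    using K.a_closed[OF that(1,2)] that by simp
  ultimately show "K = {a \<in> carrier R. (a, \<zero>\<^bsub>S\<^esub>) \<in> K} \<times> {b \<in> carrier S. (\<zero>\<^bsub>R\<^esub>, b) \<in> K}"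
    unfolding set_eq_iff split_paired_All mem_Sigma_iff mem_Collect_eq by blast
qed

text \<open>For the inclusion from right to left the factors are embedded separately, as
  \<open>(x, 0)\<close> and \<open>(0, y)\<close>, and then added. The embeddings stay inside
  because every ideal contains zero, so that \<open>(i, 0)\<close> lies in
  \<open>I \<times> J\<close>.\<close>

lemma RDirProd_ideal_prod_Times:
  assumes R: "ring R" and S: "ring S"
    and I: "ideal I R" "ideal I' R" and J: "ideal J S" "ideal J' S"
  shows "(I \<times> J) \<cdot>\<^bsub>RDirProd R S\<^esub> (I' \<times> J') = (I \<cdot>\<^bsub>R\<^esub> I') \<times> (J \<cdot>\<^bsub>S\<^esub> J')"
proof (intro equalityI subsetI)
  fix p assume "p \<in> (I \<times> J) \<cdot>\<^bsub>RDirProd R S\<^esub> (I' \<times> J')"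
  then show "p \<in> (I \<cdot>\<^bsub>R\<^esub> I') \<times> (J \<cdot>\<^bsub>S\<^esub> J')"
    by induct (auto intro: ideal_prod.intros)
next
  interpret R: ring R by fact
  interpret S: ring S by fact
  have zR: "\<zero>\<^bsub>R\<^esub> \<in> I" "\<zero>\<^bsub>R\<^esub> \<in> I'" and zS: "\<zero>\<^bsub>S\<^esub> \<in> J" "\<zero>\<^bsub>S\<^esub> \<in> J'"
    using I J by (simp_all add: additive_subgroup.zero_closed ideal.axioms(1))
  let ?P = "(I \<times> J) \<cdot>\<^bsub>RDirProd R S\<^esub> (I' \<times> J')"
  have left: "(x, \<zero>\<^bsub>S\<^esub>) \<in> ?P" if "x \<in> I \<cdot>\<^bsub>R\<^esub> I'" for x
    using that
  proof induct
    case (prod i j)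
    then show ?case
      using ideal_prod.prod[of "(i, \<zero>\<^bsub>S\<^esub>)" "I \<times> J" "(j, \<zero>\<^bsub>S\<^esub>)" "I' \<times> J'" "RDirProd R S"] zS by simp
  next
    case (sum s1 s2)
    then show ?case
      using ideal_prod.sum[OF sum(2,4)] by simp
  qed
  have right: "(\<zero>\<^bsub>R\<^esub>, y) \<in> ?P" if "y \<in> J \<cdot>\<^bsub>S\<^esub> J'" for y
    using that
  proof induct
    case (prod i j)
    then show ?case
      using ideal_prod.prod[of "(\<zero>\<^bsub>R\<^esub>, i)" "I \<times> J" "(\<zero>\<^bsub>R\<^esub>, j)" "I' \<times> J'" "RDirProd R S"] zR by simp
  next
    case (sum s1 s2)
    then show ?case
      using ideal_prod.sum[OF sum(2,4)] by simp
  qed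
  fix p assume "p \<in> (I \<cdot>\<^bsub>R\<^esub> I') \<times> (J \<cdot>\<^bsub>S\<^esub> J')"
  then obtain x y where xy: "p = (x, y)" "x \<in> I \<cdot>\<^bsub>R\<^esub> I'" "y \<in> J \<cdot>\<^bsub>S\<^esub> J'" by blast
  then have "x \<in> carrier R" "y \<in> carrier S"
    using R.ideal_prod_in_carrier[OF I] S.ideal_prod_in_carrier[OF J] by auto
  then show "p \<in> ?P"
    using ideal_prod.sum[OF left[OF xy(2)] right[OF xy(3)]] xy(1) by simp
qed

lemma RDirProd_ideals_set_iso:
  assumes R: "ring R" and S: "ring S"
  shows "(\<lambda>(I, J). I \<times> J) \<in> iso (ideals_set R \<times>\<times> ideals_set S) (ideals_set (RDirProd R S))"
proof -
  have "bij_betw (\<lambda>(I, J). I \<times> J) ({I. ideal I R} \<times> {J. ideal J S}) {K. ideal K (RDirProd R S)}"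
  \<comment> \<open>The inverse takes the sections of \<open>K\<close> along the two axes; since
    \<open>I\<close> and \<open>J\<close> contain zero, the sections of \<open>I \<times> J\<close>
    are \<open>I\<close> and \<open>J\<close> again.\<close>
  proof (rule bij_betw_byWitness[where f' = "\<lambda>K. ({a \<in> carrier R. (a, \<zero>\<^bsub>S\<^esub>) \<in> K}, {b \<in> carrier S. (\<zero>\<^bsub>R\<^esub>, b) \<in> K})"])
    show "\<forall>p\<in>{I. ideal I R} \<times> {J. ideal J S}.
       ({a \<in> carrier R. (a, \<zero>\<^bsub>S\<^esub>) \<in> (case p of (I, J) \<Rightarrow> I \<times> J)},
        {b \<in> carrier S. (\<zero>\<^bsub>R\<^esub>, b) \<in> (case p of (I, J) \<Rightarrow> I \<times> J)}) = p"
      by (auto simp: additive_subgroup.zero_closed ideal.axioms(1) ideal.Icarr)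
    show "(\<lambda>K. ({a \<in> carrier R. (a, \<zero>\<^bsub>S\<^esub>) \<in> K}, {b \<in> carrier S. (\<zero>\<^bsub>R\<^esub>, b) \<in> K})) `
        {K. ideal K (RDirProd R S)} \<subseteq> {I. ideal I R} \<times> {J. ideal J S}"
      using RDirProd_ideal_sections(1,2)[OF R S] by auto
  qed (use RDirProd_ideal_Times[OF R S] RDirProd_ideal_sections(3)[OF R S] in auto)
  then show ?thesis
    using RDirProd_ideal_Times[OF R S] RDirProd_ideal_prod_Times[OF R S]
    by (auto simp: iso_def hom_def)
qed

lemma ideal_zero_prod_prob_RDirProd:
  assumes R: "cring R" and S: "cring S"
  shows "ideal_zero_prod_prob k (RDirProd R S) =
         ideal_zero_prod_prob k R * ideal_zero_prod_prob k S"
proof -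
  interpret R: cring R by fact
  interpret S: cring S by fact
  interpret RS: cring "RDirProd R S"
    by (rule RDirProd_cring) fact+
  note cm = R.ideals_set_is_comm_monoid S.ideals_set_is_comm_monoid
  note iso = RDirProd_ideals_set_iso[OF R.ring_axioms S.ring_axioms]
  have "card (carrier (ideals_set R \<times>\<times> ideals_set S)) = card (carrier (ideals_set (RDirProd R S)))"
    using iso by (intro bij_betw_same_card) (auto simp: iso_def)
  then have "card {K. ideal K (RDirProd R S)} = card {I. ideal I R} * card {J. ideal J S}"
    by (simp add: card_cartesian_product)
  moreover have "card (zero_product_tuples k (RDirProd R S)) =
      card (zero_product_tuples k R) * card (zero_product_tuples k S)"
    using card_tuples_with_product_iso[OF comm_monoid_DirProd[OF cm] RS.ideals_set_is_comm_monoid iso,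
        of "({\<zero>\<^bsub>R\<^esub>}, {\<zero>\<^bsub>S\<^esub>})" k] R.zeroideal S.zeroideal
      card_tuples_with_product_DirProd[OF cm, of k "{\<zero>\<^bsub>R\<^esub>}" "{\<zero>\<^bsub>S\<^esub>}"]
    by (simp add: zero_product_tuples_eq)
  ultimately show ?thesis
    by (simp add: ideal_zero_prod_prob_def power_mult_distrib)
qed

section \<open>The zero ring and products of lists of rings\<close>

lemma cring_nil_ring: "cring nil_ring"
proof -
  have "ring nil_ring"
    using RDirProd_list_is_ring[of "[]"] by simp
  then interpret ring nil_ring .
  show ?thesis
    by unfold_locales (auto simp: monoid.defs)
qed

text \<open>The zero ring has a single ideal, which is both \<open>(0)\<close> and the whole ring,
  so every tuple counts. The value 1 is the empty product that starts the induction over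
  lists.\<close>

lemma ideal_zero_prod_prob_nil_ring: "ideal_zero_prod_prob k (nil_ring :: 'a list ring) = 1"
proof -
  let ?N = "nil_ring :: 'a list ring"
  interpret N: cring ?N by (rule cring_nil_ring)
  interpret I: comm_monoid "ideals_set ?N"
    by (rule N.ideals_set_is_comm_monoid)
  have ideals: "{I. ideal I ?N} = {{[]}}"
  proof (intro equalityI subsetI)
    fix I assume "I \<in> {I. ideal I ?N}"
    then have "[] \<in> I" "I \<subseteq> {[]}"
      using additive_subgroup.zero_closed[of I ?N] ideal.Icarr[of I ?N]
      by (auto simp: ideal_def monoid.defs)
    then show "I \<in> {{[]}}" by auto
  qed (use N.zeroideal in \<open>simp add: monoid.defs\<close>)
  have "zero_product_tuples k ?N = {..<k} \<rightarrow>\<^sub>E {I. ideal I ?N}"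
  proof -
    have "finprod (ideals_set ?N) f {..<k} = {[]}" if "f \<in> {..<k} \<rightarrow>\<^sub>E {I. ideal I ?N}" for f
      using I.finprod_closed[of f "{..<k}"] that ideals
      by (metis Int_iff PiE_def ideals_set_simps(1) singletonD)
    then show ?thesis
      by (auto simp: zero_product_tuples_def monoid.defs)
  qed
  then show ?thesis
    by (simp add: ideal_zero_prod_prob_def ideals card_PiE)
qed

lemma RDirProd_list_cring:
  assumes "\<And>R. R \<in> set Rs \<Longrightarrow> cring R"
  shows "cring (RDirProd_list Rs)"
  using assms
proof (induct Rs)
  case Nil
  then show ?case by (simp add: cring_nil_ring)
next
  case (Cons R Rs)
  then have "cring (RDirProd R (RDirProd_list Rs))"
    by (intro RDirProd_cring) auto
  \<comment> \<open>Preservation of zero is not part of the definition of \<open>ring_iso\<close>,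
    so the transported structure has the image of zero as its zero;
    \<open>RDirProd_list_zero'\<close> identifies this with the zero already there.\<close>
  from cring.ring_iso_imp_img_cring[OF this RDirProd_list_iso1]
  have "cring (RDirProd_list (R # Rs) \<lparr>zero := \<zero>\<^bsub>RDirProd_list (R # Rs)\<^esub>\<rparr>)"
    by (simp add: RDirProd_list_zero')
  then show ?case by simp
qed

lemma ideal_zero_prod_prob_RDirProd_list:
  assumes "\<And>R. R \<in> set Rs \<Longrightarrow> cring R"
  shows "ideal_zero_prod_prob k (RDirProd_list Rs) =
         prod_list (map (ideal_zero_prod_prob k) Rs)"
  using assms
proof (induct Rs)
  case Nil
  then show ?case by (simp add: ideal_zero_prod_prob_nil_ring)
next
  case (Cons R Rs)
  then have cr: "cring R" "cring (RDirProd_list Rs)"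
    by (auto intro: RDirProd_list_cring)
  have "RDirProd R (RDirProd_list Rs) \<simeq> RDirProd_list (R # Rs)"
    using RDirProd_list_iso1 by (auto simp: is_ring_iso_def)
  then have "ideal_zero_prod_prob k (RDirProd_list (R # Rs)) =
      ideal_zero_prod_prob k (RDirProd R (RDirProd_list Rs))"
    using Cons(2) by (intro ideal_zero_prod_prob_iso[symmetric] RDirProd_cring cr RDirProd_list_cring)
  then show ?case
    using Cons by (simp add: ideal_zero_prod_prob_RDirProd[OF cr])
qed

subsection \<open>Truncated addition and stars and bars\<close>

text \<open>The element \<open>n\<close> is absorbing and will stand for the ideal
  \<open>(0)\<close>; the unit \<open>0\<close> will stand for the whole ring.\<close>

definition truncated_add :: "nat \<Rightarrow> nat monoid" where
  "truncated_add n = \<lparr>carrier = {..n}, monoid.mult = (\<lambda>a b. min (a + b) n), one = 0\<rparr>"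

lemma truncated_add_simps [simp]:
  "carrier (truncated_add n) = {..n}"
  "a \<otimes>\<^bsub>truncated_add n\<^esub> b = min (a + b) n"
  "\<one>\<^bsub>truncated_add n\<^esub> = 0"
  by (simp_all add: truncated_add_def)

lemma comm_monoid_truncated_add: "comm_monoid (truncated_add n)"
  by unfold_locales (auto simp: Units_def min_def)

lemma finprod_truncated_add:
  assumes "f \<in> A \<rightarrow> {..n}" "finite A"
  shows "finprod (truncated_add n) f A = min (sum f A) n"
proof -
  interpret comm_monoid "truncated_add n" by (rule comm_monoid_truncated_add)
  from assms(2,1) show ?thesis
  proof (induct A rule: finite_induct)
    case (insert x F)
    then have "f \<in> F \<rightarrow> carrier (truncated_add n)" "f x \<in> carrier (truncated_add n)" by auto
    with insert show ?case by simp
  qed simp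
qed

lemma tuples_with_product_truncated_add:
  "tuples_with_product k (truncated_add n) n = {f \<in> {..<k} \<rightarrow>\<^sub>E {..n}. n \<le> sum f {..<k}}"
proof -
  have "finprod (truncated_add n) f {..<k} = n \<longleftrightarrow> n \<le> sum f {..<k}"
    if "f \<in> {..<k} \<rightarrow>\<^sub>E {..n}" for f
    using finprod_truncated_add[of f "{..<k}" n] that by (auto simp: PiE_iff Pi_iff)
  then show ?thesis
    by (auto simp: tuples_with_product_def)
qed

text \<open>Functions are read as lists of their values, which reduces the count to lists of length
  \<open>k\<close> with sum \<open>t\<close>; \<open>t < n\<close> puts every entry of such a list
  below the bound. Truncated subtraction keeps the formula right for \<open>k = 0\<close>: it gives
  1 for \<open>t = 0\<close> and \<open>(t - 1) choose t = 0\<close> for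
  \<open>t > 0\<close>.\<close>

lemma card_tuples_sum_eq:
  assumes "t < n"
  shows "card {f \<in> {..<k} \<rightarrow>\<^sub>E {..n}. sum f {..<k} = t} = (t + k - 1) choose t"
proof -
  have nth: "(\<lambda>i\<in>{..<k}. map f [0..<k] ! i) = f" if "f \<in> {..<k} \<rightarrow>\<^sub>E {..n}" for f :: "nat \<Rightarrow> nat"
    using that by (auto simp: fun_eq_iff PiE_iff extensional_def)
  have sums: "sum_list (map f [0..<k]) = sum f {..<k}" for f :: "nat \<Rightarrow> nat"
    by (simp add: interv_sum_list_conv_sum_set_nat lessThan_atLeast0)
  have bound: "l ! i \<le> n" if "length l = k" "sum_list l = t" "i < k" for l :: "nat list" and i
    using elem_le_sum_list[of i l] that assms by simp
  have "bij_betw (\<lambda>f. map f [0..<k]) {f \<in> {..<k} \<rightarrow>\<^sub>E {..n}. sum f {..<k} = t}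
      {l. length l = k \<and> sum_list l = t}"
  proof (rule bij_betw_byWitness[where f' = "\<lambda>l. \<lambda>i\<in>{..<k}. l ! i"])
    show "\<forall>f\<in>{f \<in> {..<k} \<rightarrow>\<^sub>E {..n}. sum f {..<k} = t}. (\<lambda>i\<in>{..<k}. map f [0..<k] ! i) = f"
      using nth by auto
    show "\<forall>l\<in>{l. length l = k \<and> sum_list l = t}. map (\<lambda>i\<in>{..<k}. l ! i) [0..<k] = l"
      by (auto intro: nth_equalityI)
    show "(\<lambda>f. map f [0..<k]) ` {f \<in> {..<k} \<rightarrow>\<^sub>E {..n}. sum f {..<k} = t}
        \<subseteq> {l. length l = k \<and> sum_list l = t}"
      using sums by auto
    show "(\<lambda>l. \<lambda>i\<in>{..<k}. l ! i) ` {l. length l = k \<and> sum_list l = t}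
        \<subseteq> {f \<in> {..<k} \<rightarrow>\<^sub>E {..n}. sum f {..<k} = t}"
      using bound by (auto simp: sum_list_sum_nth lessThan_atLeast0)
  qed
  then show ?thesis
    using card_length_sum_list[of k t] by (simp add: bij_betw_same_card)
qed

text \<open>The complement is counted instead, split by the value \<open>t\<close> of the
  sum.\<close>

lemma card_tuples_sum_ge:
  assumes "0 < n"
  shows "real (card {f \<in> {..<k} \<rightarrow>\<^sub>E {..n}. n \<le> sum f {..<k}}) =
    real (n + 1) ^ k - (\<Sum>t = 0..n - 1. real ((t + k - 1) choose t))"
proof -
  define A :: "(nat \<Rightarrow> nat) set" where "A = {..<k} \<rightarrow>\<^sub>E {..n}"
  have fin: "finite A" by (simp add: A_def finite_PiE)
  \<comment> \<open>Here \<open>0 < n\<close> matters: for \<open>n = 0\<close> the range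
    \<open>{0..n - 1}\<close> would still contain \<open>t = 0\<close>, although no sum is below
    0.\<close>
  have "{f \<in> A. sum f {..<k} < n} = (\<Union>t\<in>{0..n - 1}. {f \<in> A. sum f {..<k} = t})"
    using assms by auto
  also have "card \<dots> = (\<Sum>t = 0..n - 1. card {f \<in> A. sum f {..<k} = t})"
    using fin by (intro card_UN_disjoint) auto
  also have "\<dots> = (\<Sum>t = 0..n - 1. (t + k - 1) choose t)"
    using assms unfolding A_def by (intro sum.cong card_tuples_sum_eq) auto
  finally have less: "card {f \<in> A. sum f {..<k} < n} = (\<Sum>t = 0..n - 1. (t + k - 1) choose t)" .
  have "(n + 1) ^ k = card A"
    by (simp add: A_def card_PiE)
  also have "\<dots> = card ({f \<in> A. n \<le> sum f {..<k}} \<union> {f \<in> A. sum f {..<k} < n})"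
    by (rule arg_cong[of _ _ card]) auto
  also have "\<dots> = card {f \<in> A. n \<le> sum f {..<k}} + card {f \<in> A. sum f {..<k} < n}"
  proof (rule card_Un_disjoint)
    show "{f \<in> A. n \<le> sum f {..<k}} \<inter> {f \<in> A. sum f {..<k} < n} = {}"
      by (simp add: disjoint_iff)
  qed (rule finite_subset[OF _ fin], blast)+
  finally have "real ((n + 1) ^ k) = real (card {f \<in> A. n \<le> sum f {..<k}}) +
      (\<Sum>t = 0..n - 1. real ((t + k - 1) choose t))"
    by (simp add: less)
  then show ?thesis by (simp add: A_def)
qed

subsection \<open>Ideals of a finite chain ring\<close>

context finite_chain_ring
begin

abbreviation maxid :: "'a set" where
  "maxid \<equiv> the_maximal_ideal R"

abbreviation maxpow :: "nat \<Rightarrow> 'a set" where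
  "maxpow n \<equiv> maxid [^]\<^bsub>ideals_set R\<^esub> n"

sublocale ideals: comm_monoid "ideals_set R"
  by (rule ideals_set_is_comm_monoid)

lemma maxid_ideal: "ideal maxid R"
  using maximalideal_the_maximal_ideal by (simp add: maximalideal_def)

lemma ideal_maxpow: "ideal (maxpow n) R"
  using ideals.nat_pow_closed[of maxid n] maxid_ideal by simp

lemma maxpow_add: "maxpow (m + n) = maxpow m \<cdot> maxpow n"
  using ideals.nat_pow_mult[of maxid m n] maxid_ideal by simp

lemma ideal_prod_subset_left: "ideal I R \<Longrightarrow> ideal J R \<Longrightarrow> I \<cdot> J \<subseteq> I"
  using ideal_prod_inter by blast

lemma maxpow_antimono: "m \<le> n \<Longrightarrow> maxpow n \<subseteq> maxpow m"
  using maxpow_add[of m "n - m"] ideal_prod_subset_left[OF ideal_maxpow ideal_maxpow] by fastforce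

text \<open>The principal ideal of \<open>r\<close> is not inside \<open>maxid\<close>, so by
  linearity it contains \<open>maxid\<close> properly, and by maximality it is the whole
  ring.\<close>

lemma Units_of_not_in_maxid:
  assumes "r \<in> carrier R" "r \<notin> maxid"
  shows "r \<in> Units R"
proof -
  have "maxid \<subseteq> PIdl r"
    using ideals_linear[OF cgenideal_ideal maxid_ideal] assms cgenideal_self by blast
  moreover have "PIdl r \<noteq> maxid"
    using assms cgenideal_self by blast
  moreover have "PIdl r \<subseteq> carrier R"
    using cgenideal_ideal[OF assms(1)] ideal.Icarr by fastforce
  ultimately have "PIdl r = carrier R"
    using maximalideal.I_maximal[OF maximalideal_the_maximal_ideal cgenideal_ideal] assms by blast
  then show ?thesis
    using ideal_eq_carrier_iff[OF assms(1)] by simp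
qed

lemma one_notin_maxid: "\<one> \<notin> maxid"
  using maximalideal.I_notcarr[OF maximalideal_the_maximal_ideal] ideal.one_imp_carrier[OF maxid_ideal]
  by auto

lemma ideals_finite: "finite {I. ideal I R}"
  by (rule finite_subset[of _ "Pow (carrier R)"]) (auto simp: finite_carrier dest: ideal.Icarr)

text \<open>Choose \<open>J\<close> maximal among the finitely many ideals strictly inside
  \<open>P\<close>; the zero ideal is one of them. By linearity, any \<open>y\<close> in
  \<open>P\<close> outside \<open>J\<close> generates an ideal strictly above \<open>J\<close> and
  inside \<open>P\<close>, hence \<open>P\<close> itself.\<close>

lemma ideal_eq_PIdl:
  assumes P: "ideal P R" "P \<noteq> {\<zero>}"
  obtains y where "y \<in> P" "P = PIdl y"
proof -
  let ?S = "{J. ideal J R \<and> J \<subset> P}"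
  have "{\<zero>} \<in> ?S"
    using P zeroideal additive_subgroup.zero_closed[OF ideal.axioms(1)[OF P(1)]] by auto
  moreover have "finite ?S"
    by (rule finite_subset[OF _ ideals_finite]) auto
  ultimately obtain J where J: "J \<in> ?S" "\<And>K. K \<in> ?S \<Longrightarrow> J \<subseteq> K \<Longrightarrow> J = K"
    by (metis (no_types, lifting) finite_has_maximal empty_iff)
  then obtain y where y: "y \<in> P" "y \<notin> J" by blast
  then have yc: "y \<in> carrier R" using ideal.Icarr[OF P(1)] by blast
  then have "J \<subseteq> PIdl y" "J \<noteq> PIdl y" "PIdl y \<subseteq> P"
    using ideals_linear[OF cgenideal_ideal, of y J] J(1) y cgenideal_self[OF yc]
      cgenideal_minimal[OF P(1)] by blast+
  then have "P = PIdl y"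
    using J(2)[of "PIdl y"] cgenideal_ideal[OF yc] by blast
  with y that show thesis by blast
qed

text \<open>Nakayama's lemma: if \<open>P = (y)\<close> and \<open>y = m y\<close> with \<open>m\<close> in the maximal ideal, then \<open>y = 0\<close>
  because \<open>1 - m\<close> is a unit.\<close>

lemma ideal_eq_prod_maxid_imp_zero:
  assumes P: "ideal P R" and eq: "P \<cdot> maxid = P"
  shows "P = {\<zero>}"
proof (rule ccontr)
  assume "P \<noteq> {\<zero>}"
  with P obtain y where y: "y \<in> P" "P = PIdl y" by (rule ideal_eq_PIdl)
  have yc: "y \<in> carrier R" using ideal.Icarr[OF P y(1)] .
  interpret M: ideal maxid R by (rule maxid_ideal)
  \<comment> \<open>A sum of terms \<open>(r \<otimes> y) \<otimes> j\<close> with \<open>j\<close>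
    in \<open>maxid\<close> collapses to a single multiple of \<open>y\<close>, since
    \<open>maxid\<close> contains each \<open>r \<otimes> j\<close> and is closed under sums. Taking
    \<open>s\<close> to be \<open>y\<close> itself yields \<open>m\<close>.\<close>
  have "\<exists>m\<in>maxid. s = m \<otimes> y" if "s \<in> P \<cdot> maxid" for s
    using that
  proof induct
    case (prod i j)
    then obtain r where r: "r \<in> carrier R" "i = r \<otimes> y"
      using y(2) by (auto simp: cgenideal_def)
    have "i \<otimes> j = (r \<otimes> j) \<otimes> y"
      using r prod M.Icarr yc by (simp add: m_ac)
    moreover have "r \<otimes> j \<in> maxid"
      using prod r M.I_l_closed by blast
    ultimately show ?case by blast
  next
    case (sum s1 s2)
    then obtain a b where ab: "a \<in> maxid" "b \<in> maxid" "s1 = a \<otimes> y" "s2 = b \<otimes> y" by blast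
    then have "s1 \<oplus> s2 = (a \<oplus> b) \<otimes> y"
      using M.Icarr yc by (simp add: l_distr)
    then show ?case
      using ab M.a_closed by blast
  qed
  then obtain m where m: "m \<in> maxid" "y = m \<otimes> y"
    using y(1) eq by blast
  have mc: "m \<in> carrier R" using m M.Icarr by blast
  have "\<one> \<ominus> m \<notin> maxid"
  proof
    assume "\<one> \<ominus> m \<in> maxid"
    then have "(\<one> \<ominus> m) \<oplus> m \<in> maxid" using m(1) M.a_closed by blast
    moreover have "(\<one> \<ominus> m) \<oplus> m = \<one>" using mc by algebra
    ultimately show False using one_notin_maxid by simp
  qed
  then have u: "\<one> \<ominus> m \<in> Units R"
    using mc by (intro Units_of_not_in_maxid) auto
  have "(\<one> \<ominus> m) \<otimes> y = y \<ominus> m \<otimes> y" using mc yc by algebra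
  also have "\<dots> = \<zero>" using m(2)[symmetric] yc by (simp add: minus_eq r_neg)
  finally have "(\<one> \<ominus> m) \<otimes> y = (\<one> \<ominus> m) \<otimes> \<zero>" using mc by simp
  then have "y = \<zero>" using u yc by (metis Units_l_cancel zero_closed)
  then show False
    using y \<open>P \<noteq> {\<zero>}\<close> by (auto simp: cgenideal_def)
qed

section \<open>Powers of the maximal ideal\<close>

lemma maxpow_Suc_eq_imp_zero:
  assumes "maxpow (Suc i) = maxpow i"
  shows "maxpow i = {\<zero>}"
  using assms ideal_eq_prod_maxid_imp_zero[OF ideal_maxpow, of i] by simp

lemma maxpow_nilpotent: "\<exists>n>0. maxpow n = {\<zero>}"
proof (rule ccontr)
  assume no: "\<not> ?thesis"
  \<comment> \<open>By Nakayama, consecutive nonzero powers differ, so the powers would form an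
    infinite strictly decreasing chain in a finite set of ideals. Exponents are shifted by
    \<open>Suc\<close> because the negated claim concerns positive \<open>n\<close> only.\<close>
  have "maxpow (Suc (Suc i)) \<noteq> maxpow (Suc i)" for i
    using no maxpow_Suc_eq_imp_zero[of "Suc i"] by blast
  moreover have "maxpow (Suc j) \<subseteq> maxpow (Suc (Suc i))" "maxpow (Suc (Suc i)) \<subseteq> maxpow (Suc i)"
    if "i < j" for i j
    by (rule maxpow_antimono, use that in simp)+
  ultimately have "maxpow (Suc i) \<noteq> maxpow (Suc j)" if "i < j" for i j
    using that by blast
  then have "inj (\<lambda>i. maxpow (Suc i))"
    by (intro linorder_injI)
  moreover have "range (\<lambda>i. maxpow (Suc i)) \<subseteq> {I. ideal I R}"
    using ideal_maxpow by blast
  ultimately show False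
    using ideals_finite by (meson finite_imageD finite_subset infinite_UNIV_nat)
qed

lemma loewy_length_pos: "0 < loewy_length R"
  and maxpow_loewy_length: "maxpow (loewy_length R) = {\<zero>}"
  using LeastI_ex[of "\<lambda>n. 0 < n \<and> maxpow n = {\<zero>}"] maxpow_nilpotent
  unfolding loewy_length_def by blast+

lemma maxpow_eq_zero_iff: "maxpow i = {\<zero>} \<longleftrightarrow> loewy_length R \<le> i"
proof
  assume z: "maxpow i = {\<zero>}"
  \<comment> \<open>The zeroth power is the whole ring, which contains one and so is not
    \<open>(0)\<close>; this supplies the positivity demanded in
    \<open>loewy_length\<close>.\<close>
  then have "i \<noteq> 0"
    using nonzero one_closed by (metis ideals.nat_pow_0 ideals_set_simps(3) singletonD)
  with z show "loewy_length R \<le> i"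
    unfolding loewy_length_def by (intro Least_le) auto
next
  assume "loewy_length R \<le> i"
  then have "maxpow i \<subseteq> {\<zero>}"
    using maxpow_antimono maxpow_loewy_length by metis
  moreover have "\<zero> \<in> maxpow i"
    using ideal_maxpow by (simp add: additive_subgroup.zero_closed ideal.axioms(1))
  ultimately show "maxpow i = {\<zero>}" by blast
qed

text \<open>If the powers \<open>i < j\<close> agree, the power \<open>Suc i\<close> is squeezed
  between them, so Nakayama makes the power \<open>i\<close> zero. Then \<open>i\<close> is at least
  the Loewy length, while \<open>j\<close> is at most that.\<close>

lemma inj_on_maxpow: "inj_on maxpow {..loewy_length R}"
proof (rule linorder_inj_onI)
  fix i j assume ij: "i < j" "i \<in> {..loewy_length R}" "j \<in> {..loewy_length R}"
  show "maxpow i \<noteq> maxpow j"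
  proof
    assume "maxpow i = maxpow j"
    then have "maxpow (Suc i) = maxpow i"
      using maxpow_antimono[of "Suc i" j] maxpow_antimono[of i "Suc i"] ij(1) by auto
    then have "loewy_length R \<le> i"
      using maxpow_Suc_eq_imp_zero maxpow_eq_zero_iff by blast
    with ij show False by simp
  qed
qed auto

text \<open>With \<open>i\<close> maximal such that \<open>I \<subseteq> M\<^sup>i\<close>, pick \<open>x \<in> I - M\<^sup>i\<^sup>+\<^sup>1\<close>. Any
  \<open>y \<in> M\<^sup>i - I\<close> would divide \<open>x\<close>, necessarily by a unit as \<open>x \<notin> M\<^sup>i\<^sup>+\<^sup>1\<close>, so \<open>y \<in> I\<close>.\<close>

lemma ideal_eq_maxpow:
  assumes I: "ideal I R"
  shows "\<exists>i\<le>loewy_length R. I = maxpow i"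
proof (cases "I = {\<zero>}")
  case True
  then show ?thesis using maxpow_loewy_length by blast
next
  case False
  interpret I: ideal I R by fact
  let ?Q = "\<lambda>i. I \<subseteq> maxpow i"
  \<comment> \<open>\<open>Greatest\<close> needs an upper bound on the exponents: a nonzero ideal
    lies in no vanishing power.\<close>
  have bd: "i < loewy_length R" if "?Q i" for i
  proof (rule ccontr)
    assume "\<not> i < loewy_length R"
    then have "maxpow i = {\<zero>}" using maxpow_eq_zero_iff by simp
    then show False using that False I.zero_closed by blast
  qed
  have "?Q 0" using I.Icarr by auto
  define i where "i = Greatest ?Q"
  have Qi: "?Q i"
    unfolding i_def by (rule GreatestI_nat[of ?Q 0 "loewy_length R"]) (use bd less_imp_le \<open>?Q 0\<close> in blast)+
  have "\<not> ?Q (Suc i)"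
  proof
    assume "?Q (Suc i)"
    then have "Suc i \<le> i"
      unfolding i_def by (rule Greatest_le_nat[of ?Q _ "loewy_length R"]) (use bd less_imp_le in blast)
    then show False by simp
  qed
  then obtain x where x: "x \<in> I" "x \<notin> maxpow (Suc i)" by blast
  have "maxpow i \<subseteq> I"
  proof
    fix y assume y: "y \<in> maxpow i"
    have yc: "y \<in> carrier R" using ideal.Icarr[OF ideal_maxpow y] .
    show "y \<in> I"
    proof (rule ccontr)
      assume "y \<notin> I"
      then have "I \<subseteq> PIdl y"
        using ideals_linear[OF I cgenideal_ideal[OF yc]] cgenideal_self[OF yc] by blast
      then obtain r where r: "r \<in> carrier R" "x = r \<otimes> y"
        using x(1) by (auto simp: cgenideal_def)
      have "r \<notin> maxid"
      proof
        assume "r \<in> maxid"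
        then have "y \<otimes> r \<in> maxpow i \<cdot> maxid"
          using y by (intro ideal_prod.prod)
        then show False using x(2) r yc by (simp add: m_comm)
      qed
      then have u: "r \<in> Units R" using r(1) by (intro Units_of_not_in_maxid)
      then have "inv r \<otimes> x = y"
        using r yc by (simp add: m_assoc[symmetric])
      moreover have "inv r \<otimes> x \<in> I"
        using u x(1) I.I_l_closed by simp
      ultimately show False using \<open>y \<notin> I\<close> by simp
    qed
  qed
  then have "I = maxpow i" using Qi by blast
  then show ?thesis using bd[OF Qi] less_imp_le by blast
qed

lemma maxpow_truncated_add_iso:
  "maxpow \<in> iso (truncated_add (loewy_length R)) (ideals_set R)"
proof -
  let ?n = "loewy_length R"
  \<comment> \<open>Once \<open>a + b\<close> exceeds \<open>?n\<close> both sides are zero, so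
    truncating the exponent loses nothing.\<close>
  have "maxpow (min (a + b) ?n) = maxpow a \<cdot> maxpow b" for a b
    using maxpow_eq_zero_iff[of "a + b"] maxpow_loewy_length maxpow_add[of a b]
    by (cases "a + b \<le> ?n") (simp_all add: min_def)
  moreover have "bij_betw maxpow {..?n} {I. ideal I R}"
    unfolding bij_betw_def using inj_on_maxpow ideal_maxpow ideal_eq_maxpow by fastforce
  ultimately show ?thesis
    using ideal_maxpow by (auto simp: iso_def hom_def)
qed

lemma ideal_zero_prod_prob_chain:
  "ideal_zero_prod_prob k R =
     1 - (\<Sum>t = 0..loewy_length R - 1. real ((t + k - 1) choose t)) / real (loewy_length R + 1) ^ k"
proof -
  let ?n = "loewy_length R"
  note iso = maxpow_truncated_add_iso
  have "card (carrier (truncated_add ?n)) = card (carrier (ideals_set R))"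
    using iso by (intro bij_betw_same_card) (auto simp: iso_def)
  then have ideals: "card {I. ideal I R} = ?n + 1" by simp
  \<comment> \<open>The zero ideal is the image of the absorbing element \<open>?n\<close> under
    \<open>maxpow\<close>.\<close>
  have "card (zero_product_tuples k R) = card (tuples_with_product k (truncated_add ?n) ?n)"
    using card_tuples_with_product_iso[OF comm_monoid_truncated_add ideals.comm_monoid_axioms iso, of ?n k]
      maxpow_loewy_length by (simp add: zero_product_tuples_eq)
  then have "real (card (zero_product_tuples k R)) =
      real (?n + 1) ^ k - (\<Sum>t = 0..?n - 1. real ((t + k - 1) choose t))"
    unfolding tuples_with_product_truncated_add using card_tuples_sum_ge[OF loewy_length_pos] by simp
  then show ?thesis
    unfolding ideal_zero_prod_prob_def ideals by (simp add: diff_divide_distrib)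
qed

end

section \<open>Evaluation of the formula for a list of chain rings\<close>

lemma inclusion_exclusion_sum_small:
  assumes "t \<le> n" "0 < k"
  shows "(\<Sum>j = 0..t div (n + 1). (-1) ^ j * real (k choose j) *
      real ((t - j * (n + 1) + k - 1) choose (k - 1))) = real ((t + k - 1) choose t)"
proof -
  have "t div (n + 1) = 0" using assms(1) by simp
  \<comment> \<open>Symmetry of binomial coefficients requires \<open>t \<le> t + k - 1\<close>,
    which \<open>0 < k\<close> guarantees under truncated subtraction.\<close>
  moreover have "(t + k - 1) choose (k - 1) = (t + k - 1) choose t"
    using assms(2) binomial_symmetric[of t "t + k - 1"] by simp
  ultimately show ?thesis by simp
qed

text \<open>The components enter the right-hand side only through the list of their Loewy lengths;
  both the closed formula and the dependence on these lengths alone are read off from this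
  form.\<close>

lemma ideal_zero_prod_prob_RDirProd_list_chain:
  fixes R :: "('r, 'e) ring_scheme" and Rs :: "('a, 'f) ring_scheme list"
  assumes R: "finite_principal_ideal_ring R"
    and Rs: "\<And>i. i < length Rs \<Longrightarrow> finite_chain_ring (Rs ! i)"
    and iso: "R \<simeq> RDirProd_list Rs"
  shows "ideal_zero_prod_prob k R = prod_list (map
    (\<lambda>n. 1 - (\<Sum>t = 0..n - 1. real ((t + k - 1) choose t)) / real (n + 1) ^ k) (map loewy_length Rs))"
proof -
  have chain: "finite_chain_ring S" if "S \<in> set Rs" for S
    using Rs that by (auto simp: in_set_conv_nth)
  then have cr: "cring S" if "S \<in> set Rs" for S
    using that by (simp add: finite_chain_ring_def)
  have "cring R"
    using R by (simp add: finite_principal_ideal_ring_def)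
  then have "ideal_zero_prod_prob k R = ideal_zero_prod_prob k (RDirProd_list Rs)"
    using iso cr by (intro ideal_zero_prod_prob_iso RDirProd_list_cring)
  also have "\<dots> = prod_list (map (ideal_zero_prod_prob k) Rs)"
    using cr by (rule ideal_zero_prod_prob_RDirProd_list)
  also have "map (ideal_zero_prod_prob k) Rs = map
    (\<lambda>n. 1 - (\<Sum>t = 0..n - 1. real ((t + k - 1) choose t)) / real (n + 1) ^ k) (map loewy_length Rs)"
    using chain finite_chain_ring.ideal_zero_prod_prob_chain by auto
  finally show ?thesis .
qed

theorem theorem5p4:
  fixes R :: "('r, 'e) ring_scheme"
    and Rs :: "('a, 'f) ring_scheme list"
    and k :: nat
  assumes "finite_principal_ideal_ring R"
    and "\<And>i. i < length Rs \<Longrightarrow> finite_chain_ring (Rs ! i)"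
    and "R \<simeq> RDirProd_list Rs"
    and "k \<ge> 2"
  shows "ideal_zero_prod_prob k R =
           (\<Prod>i<length Rs. let n = loewy_length (Rs ! i) in
              1 - (\<Sum>t = 0..n - 1. \<Sum>j = 0..t div (n + 1).
                     (-1) ^ j * real (k choose j) * real ((t - j * (n + 1) + k - 1) choose (k - 1)))
                  / real (n + 1) ^ k)
         \<and> (\<forall>(S :: ('s, 'g) ring_scheme) (Ss :: ('b, 'h) ring_scheme list).
              finite_principal_ideal_ring S \<longrightarrow>
              (\<forall>i < length Ss. finite_chain_ring (Ss ! i)) \<longrightarrow>
              S \<simeq> RDirProd_list Ss \<longrightarrow>
              mset (map loewy_length Rs) = mset (map loewy_length Ss) \<longrightarrow>
              ideal_zero_prod_prob k R = ideal_zero_prod_prob k S)"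
proof (intro conjI allI impI)
  let ?F = "\<lambda>n. 1 - (\<Sum>t = 0..n - 1. real ((t + k - 1) choose t)) / real (n + 1) ^ k"
  have R: "ideal_zero_prod_prob k R = prod_list (map ?F (map loewy_length Rs))"
    using assms(1-3) by (rule ideal_zero_prod_prob_RDirProd_list_chain)
  have "ideal_zero_prod_prob k R = (\<Prod>i<length Rs. ?F (loewy_length (Rs ! i)))"
    unfolding R by (simp add: prod.list_conv_set_nth lessThan_atLeast0)
  also have "\<dots> = (\<Prod>i<length Rs. let n = loewy_length (Rs ! i) in
              1 - (\<Sum>t = 0..n - 1. \<Sum>j = 0..t div (n + 1).
                     (-1) ^ j * real (k choose j) * real ((t - j * (n + 1) + k - 1) choose (k - 1)))
                  / real (n + 1) ^ k)"
  proof (rule prod.cong[OF refl])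
    fix i
    let ?n = "loewy_length (Rs ! i)"
    have "(\<Sum>t = 0..?n - 1. real ((t + k - 1) choose t)) =
        (\<Sum>t = 0..?n - 1. \<Sum>j = 0..t div (?n + 1).
           (-1) ^ j * real (k choose j) * real ((t - j * (?n + 1) + k - 1) choose (k - 1)))"
      using assms(4) by (intro sum.cong refl inclusion_exclusion_sum_small[symmetric]) auto
    then show "?F ?n = (let n = ?n in
        1 - (\<Sum>t = 0..n - 1. \<Sum>j = 0..t div (n + 1).
               (-1) ^ j * real (k choose j) * real ((t - j * (n + 1) + k - 1) choose (k - 1)))
            / real (n + 1) ^ k)"
      unfolding Let_def by simp
  qed
  finally show "ideal_zero_prod_prob k R = \<dots>" .
  fix S :: "('s, 'g) ring_scheme" and Ss :: "('b, 'h) ring_scheme list"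
  assume S: "finite_principal_ideal_ring S" "\<forall>i < length Ss. finite_chain_ring (Ss ! i)"
    "S \<simeq> RDirProd_list Ss" and eq: "mset (map loewy_length Rs) = mset (map loewy_length Ss)"
  have "ideal_zero_prod_prob k S = prod_list (map ?F (map loewy_length Ss))"
    using S by (intro ideal_zero_prod_prob_RDirProd_list_chain) auto
  \<comment> \<open>Multiplication of reals is commutative, so a product over a list depends only on
    the multiset of its entries; the order of the components is immaterial.\<close>
  moreover have "prod_list (map ?F (map loewy_length Rs)) = prod_list (map ?F (map loewy_length Ss))"
    using arg_cong[OF eq, of "\<lambda>M. prod_mset (image_mset ?F M)"]
    by (simp only: prod_mset_prod_list mset_map[symmetric])
  ultimately show "ideal_zero_prod_prob k R = ideal_zero_prod_prob k S"
    using R by simp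
qed

end
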